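(* Let $\mathcal{A}$ be a central and essential arrangement in $\mathbb{Q}^l$ as in the context, let $\sigma$ be a term ordering and $p$ a prime. Then the following are equivalent: (1) $p$ is good and $(\sigma,l)$-lucky for $\mathcal{A}$; (2) $\mathcal{A}$ and $\mathcal{A}_p$ are combinatorially equivalent.
   Context: $\mathcal{A}=\{H_1,\dots,H_n\}$ is an arrangement of $n$ distinct, linearly ordered linear hyperplanes in $\mathbb{Q}^l$ with $\bigcap_iH_i=\{0\}$. $H_i=\{\alpha_i=0\}$ with $\alpha_i\in\mathbb{Z}[x_1,\dots,x_l]$ a nonzero linear form whose coefficients are not all divisible by any prime; $Q(\mathcal{A})=\prod\alpha_i$. $\pi_p$ denotes reduction mod $p$ and $(\alpha_i)_p=\pi_p(\alpha_i)$; $p$ is good if $\pi_p(Q(\mathcal{A}))$ is reduced (no $(\alpha_i)_p$ is a scalar multiple of $(\alpha_j)_p$ for $i<j$). $\mathcal{A}_p=\{(H_1)_p,\dots,(H_n)_p\}$ is the arrangement (hyperplanes counted with the indexing) in $\mathbb{F}_p^l$ with $(H_i)_p=\{(\alpha_i)_p=0\}$. Two indexed families $\{H^{(1)}_i\}_{i=1}^n$ in $K_1^l$ and $\{H^{(2)}_i\}_{i=1}^n$ in $K_2^l$ are combinatorially equivalent if $\dim(H^{(1)}_{i_1}\cap\dots\cap H^{(1)}_{i_k})=\dim(H^{(2)}_{i_1}\cap\dots\cap H^{(2)}_{i_k})$ for all $1\le i_1<\dots<i_k\le n$ (dimension of $\emptyset$ is $-1$). Gröbner notions: for a term ordering $\sigma$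 and nonzero $f\in\mathbb{Z}[x_1,\dots,x_l]$, $\mathrm{LT}_\sigma(f)$ is the $\sigma$-largest term of $f$, $\mathrm{LC}_\sigma(f)$ its coefficient, $\mathrm{LM}_\sigma(f)=\mathrm{LC}_\sigma(f)\mathrm{LT}_\sigma(f)$. A finite set $G$ of nonzero elements of an ideal $I\subseteq\mathbb{Z}[x_1,\dots,x_l]$ is a minimal strong $\sigma$-Gröbner basis if it generates $I$, every nonzero $f\in I$ has $\mathrm{LM}_\sigma(f)$ divisible by some $\mathrm{LM}_\sigma(g)$, $g\in G$, and no $\mathrm{LM}_\sigma(g)$ divides $\mathrm{LM}_\sigma(g')$ for distinct $g,g'\in G$; the set of leading coefficients is independent of the choice. $p$ is $\sigma$-lucky for $I$ if $p$ divides no leading coefficient of a minimal strong $\sigma$-Gröbner basis of $I$. For $1\le k\le n$, $p$ is $(\sigma,k)$-lucky for $\mathcal{A}$ if $p$ is $\sigma$-lucky for every ideal $\langle\alpha_{i_1},\dots,\alpha_{i_k}\rangle\subseteq\mathbb{Z}[x_1,\dots,x_l]$ with $i_1<\dots<i_k$ and $\operatorname{codim}(H_{i_1}\cap\dots\cap H_{i_k})=k$. *)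

theory Defs
  imports "HOL-Library.Poly_Mapping" "HOL-Library.Function_Algebras" "Berlekamp_Zassenhaus.Finite_Field"
begin

(* Variables x_1..x_l are indexed by a finite type 'l (l = CARD('l)).
   Monomials: 'l \<Rightarrow>\<^sub>0 nat (exponent vectors).
   Polynomials in Z[x_1..x_l]: ('l \<Rightarrow>\<^sub>0 nat) \<Rightarrow>\<^sub>0 int. *)

type_synonym 'l monom = "'l \<Rightarrow>\<^sub>0 nat"
type_synonym 'l zpoly = "'l monom \<Rightarrow>\<^sub>0 int"

definition term_order :: "('l monom \<Rightarrow> 'l monom \<Rightarrow> bool) \<Rightarrow> bool" where
  "term_order tord \<longleftrightarrow>
     (\<forall>a. tord a a) \<and>
     (\<forall>a b. tord a b \<and> tord b a \<longrightarrow> a = b) \<and>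
     (\<forall>a b c. tord a b \<and> tord b c \<longrightarrow> tord a c) \<and>
     (\<forall>a b. tord a b \<or> tord b a) \<and>
     (\<forall>a. tord 0 a) \<and>
     (\<forall>a b c. tord a b \<longrightarrow> tord (a + c) (b + c))"

definition LT :: "('l monom \<Rightarrow> 'l monom \<Rightarrow> bool) \<Rightarrow> 'l zpoly \<Rightarrow> 'l monom" where
  "LT tord f = (THE m. m \<in> Poly_Mapping.keys f \<and> (\<forall>m'\<in>Poly_Mapping.keys f. tord m' m))"

definition LC :: "('l monom \<Rightarrow> 'l monom \<Rightarrow> bool) \<Rightarrow> 'l zpoly \<Rightarrow> int" where
  "LC tord f = Poly_Mapping.lookup f (LT tord f)"

definition LM :: "('l monom \<Rightarrow> 'l monom \<Rightarrow> bool) \<Rightarrow> 'l zpoly \<Rightarrow> 'l zpoly" where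
  "LM tord f = Poly_Mapping.single (LT tord f) (LC tord f)"

definition ideal_gen :: "'l zpoly set \<Rightarrow> 'l zpoly set" where
  "ideal_gen G = {f. \<exists>c. f = (\<Sum>g\<in>G. c g * g)}"

definition min_strong_GB ::
  "('l monom \<Rightarrow> 'l monom \<Rightarrow> bool) \<Rightarrow> 'l zpoly set \<Rightarrow> 'l zpoly set \<Rightarrow> bool" where
  "min_strong_GB tord G I \<longleftrightarrow>
     finite G \<and> G \<subseteq> I - {0} \<and> ideal_gen G = I \<and>
     (\<forall>f\<in>I. f \<noteq> 0 \<longrightarrow> (\<exists>g\<in>G. LM tord g dvd LM tord f)) \<and>
     (\<forall>g\<in>G. \<forall>g'\<in>G. g \<noteq> g' \<longrightarrow> \<not> (LM tord g dvd LM tord g'))"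

(* p is sigma-lucky for I: p divides no leading coefficient of a minimal strong
   sigma-Groebner basis of I (the set of leading coefficients does not depend
   on the choice of basis). *)
definition sigma_lucky :: "('l monom \<Rightarrow> 'l monom \<Rightarrow> bool) \<Rightarrow> nat \<Rightarrow> 'l zpoly set \<Rightarrow> bool" where
  "sigma_lucky tord p I \<longleftrightarrow>
     (\<forall>G. min_strong_GB tord G I \<longrightarrow> (\<forall>g\<in>G. \<not> int p dvd LC tord g))"

definition lin_poly :: "('l \<Rightarrow> int) \<Rightarrow> 'l zpoly" where
  "lin_poly a = (\<Sum>j\<in>UNIV. Poly_Mapping.single (Poly_Mapping.single j 1) (a j))"

(* hyperplane {x in K^l. alpha(x) = 0} for alpha with integer coefficients,
   read in the field K (K = Q, or K = F_p which gives the reduction mod p) *)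
definition hyp :: "('l::finite \<Rightarrow> int) \<Rightarrow> ('l \<Rightarrow> 'k::field) set" where
  "hyp a = {x. (\<Sum>j\<in>UNIV. of_int (a j) * x j) = 0}"

definition fscale :: "'k::field \<Rightarrow> ('l \<Rightarrow> 'k) \<Rightarrow> ('l \<Rightarrow> 'k)" where
  "fscale c x = (\<lambda>i. c * x i)"

definition sdim :: "('l \<Rightarrow> 'k::field) set \<Rightarrow> int" where
  "sdim V = (if V = {} then -1 else int (vector_space.dim fscale V))"

definition inter_hyp :: "(nat \<Rightarrow> 'l::finite \<Rightarrow> int) \<Rightarrow> nat set \<Rightarrow> ('l \<Rightarrow> 'k::field) set" where
  "inter_hyp \<alpha> S = {x. \<forall>i\<in>S. x \<in> hyp (\<alpha> i)}"

definition arrangement :: "nat \<Rightarrow> (nat \<Rightarrow> 'l::finite \<Rightarrow> int) \<Rightarrow> bool" where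
  "arrangement n \<alpha> \<longleftrightarrow>
     (\<forall>i<n. \<exists>j. \<alpha> i j \<noteq> 0) \<and>
     (\<forall>i<n. \<forall>q::int. prime q \<longrightarrow> \<not> (\<forall>j. q dvd \<alpha> i j)) \<and>
     (\<forall>i<n. \<forall>j<n. i \<noteq> j \<longrightarrow> (hyp (\<alpha> i) :: ('l \<Rightarrow> rat) set) \<noteq> hyp (\<alpha> j)) \<and>
     (inter_hyp \<alpha> {..<n} :: ('l \<Rightarrow> rat) set) = {0}"

definition good :: "nat \<Rightarrow> (nat \<Rightarrow> 'l::finite \<Rightarrow> int) \<Rightarrow> 'p::prime_card itself \<Rightarrow> bool" where
  "good n \<alpha> _ \<longleftrightarrow>
     (\<forall>i j. i < j \<and> j < n \<longrightarrow>
        \<not> (\<exists>c::'p mod_ring. \<forall>v. (of_int (\<alpha> i v) :: 'p mod_ring) = c * of_int (\<alpha> j v)))"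

definition sk_lucky :: "('l::finite monom \<Rightarrow> 'l monom \<Rightarrow> bool) \<Rightarrow> nat \<Rightarrow> nat \<Rightarrow> nat
    \<Rightarrow> (nat \<Rightarrow> 'l \<Rightarrow> int) \<Rightarrow> bool" where
  "sk_lucky tord k p n \<alpha> \<longleftrightarrow>
     (\<forall>S. S \<subseteq> {..<n} \<and> card S = k \<and>
          int CARD('l) - sdim (inter_hyp \<alpha> S :: ('l \<Rightarrow> rat) set) = int k
        \<longrightarrow> sigma_lucky tord p (ideal_gen (lin_poly ` \<alpha> ` S)))"

definition comb_equiv :: "nat \<Rightarrow> (nat \<Rightarrow> 'l::finite \<Rightarrow> int) \<Rightarrow> 'p::prime_card itself \<Rightarrow> bool" where
  "comb_equiv n \<alpha> _ \<longleftrightarrow>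
     (\<forall>S. S \<subseteq> {..<n} \<and> S \<noteq> {} \<longrightarrow>
        sdim (inter_hyp \<alpha> S :: ('l \<Rightarrow> rat) set)
        = sdim (inter_hyp \<alpha> S :: ('l \<Rightarrow> 'p mod_ring) set))"

end

theory Submission
  imports Defs
begin

text \<open>Write \<open>V\<^sub>K(F)\<close> for the common zeros in \<open>K\<^sup>l\<close> of a finite set \<open>F\<close> of integral
  linear forms and \<open>I\<^sub>F\<close> for the ideal it generates. If \<open>V\<^sub>K(F) = 0\<close>, then eliminating
  variables inside the lattice of linear forms of \<open>I\<^sub>F\<close>, localised at the integers invertible in
  \<open>K\<close>, shows that \<open>I\<^sub>F\<close> contains a multiple \<open>d x\<^sub>i\<close> of every variable with \<open>d \<noteq> 0\<close> in
  \<open>K\<close>; conversely, the linear part of every element of \<open>I\<^sub>F\<close> vanishes on \<open>V\<^sub>K(F)\<close>.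

  Let \<open>V\<^sub>\<rat>(F) = 0\<close>. A minimal strong Groebner basis of \<open>I\<^sub>F\<close> then contains for each \<open>i\<close> an
  element with leading term \<open>x\<^sub>i\<close>. If \<open>p\<close> is lucky, the linear parts of these elements form a
  triangular system that is regular modulo \<open>p\<close>, hence \<open>V\<^sub>p(F) = 0\<close>. If, on the other hand,
  \<open>V\<^sub>p(F) = 0\<close>, then \<open>d x\<^sub>i \<in> I\<^sub>F\<close> with \<open>p\<close> not dividing \<open>d\<close>, and the Bezout
  combination of a basis element \<open>g\<close> with a monomial multiple of \<open>d x\<^sub>i\<close> shows by minimality
  that the leading coefficient of \<open>g\<close> divides \<open>d\<close>. So \<open>p\<close> is \<open>(\<sigma>,l)\<close>-lucky if and only if
  every basis over \<open>\<rat>\<close> taken from the arrangement stays a basis modulo \<open>p\<close>, and since the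
  arrangement is essential this is equality of all the dimensions. Goodness then follows, as
  proportional forms modulo \<open>p\<close> would violate equality for a pair of hyperplanes.\<close>

section \<open>Dimensions of zero sets of integral linear forms\<close>

definition form_val :: "('l::finite \<Rightarrow> int) \<Rightarrow> ('l \<Rightarrow> 'k::field) \<Rightarrow> 'k" where
  "form_val a x = (\<Sum>j\<in>UNIV. of_int (a j) * x j)"

definition zeros :: "('l::finite \<Rightarrow> int) set \<Rightarrow> ('l \<Rightarrow> 'k::field) set" where
  "zeros F = {x. \<forall>a\<in>F. form_val a x = 0}"

lemma mem_hyp: "x \<in> hyp a \<longleftrightarrow> form_val a x = 0"
  by (simp add: hyp_def form_val_def)

lemma inter_hyp_eq_zeros: "inter_hyp \<alpha> S = zeros (\<alpha> ` S)"
  by (auto simp: inter_hyp_def zeros_def mem_hyp)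

lemma form_val_zero [simp]: "form_val a 0 = 0"
  by (simp add: form_val_def)

lemma form_val_add: "form_val a (x + y) = form_val a x + form_val a y"
  by (simp add: form_val_def algebra_simps sum.distrib)

lemma form_val_diff: "form_val a (x - y) = form_val a x - form_val a y"
  by (simp add: form_val_def algebra_simps sum_subtractf)

lemma form_val_fscale: "form_val a (fscale c x) = c * form_val a x"
  by (simp add: form_val_def fscale_def sum_distrib_left mult_ac)

lemma form_val_add_left: "form_val (a + b) x = form_val a x + form_val b x"
  by (simp add: form_val_def algebra_simps sum.distrib)

lemma form_val_diff_left: "form_val (a - b) x = form_val a x - form_val b x"
  by (simp add: form_val_def algebra_simps sum_subtractf)

lemma form_val_mult_left: "form_val (\<lambda>j. c * a j) x = of_int c * form_val a x"
  by (simp add: form_val_def sum_distrib_left mult_ac)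

lemma sum_apply: "(\<Sum>i\<in>A. f i) x = (\<Sum>i\<in>A. f i x)"
  by (induction A rule: infinite_finite_induct) auto

lemma form_val_unit: "form_val a (\<lambda>j. if j = i then c else 0) = of_int (a i) * c"
  by (simp add: form_val_def if_distrib cong: if_cong)

text \<open>The unit vectors are a finite basis, so the constant
  \<open>vector_space.dim fscale\<close> inside \<open>sdim\<close> obeys finite-dimensional linear
  algebra. Being polymorphic in the field, this serves \<rat> and the field with p elements at
  once.\<close>

interpretation fscale: finite_dimensional_vector_space
  "fscale :: 'k::field \<Rightarrow> ('l::finite \<Rightarrow> 'k) \<Rightarrow> 'l \<Rightarrow> 'k"
  "range (\<lambda>i j. if j = i then 1 else 0)"
proof -
  let ?u = "\<lambda>(i::'l) j. if j = i then 1 else (0::'k)"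
  interpret vs: vector_space "fscale :: 'k \<Rightarrow> ('l \<Rightarrow> 'k) \<Rightarrow> 'l \<Rightarrow> 'k"
    by unfold_locales (auto simp: fscale_def fun_eq_iff algebra_simps)
  have inj: "inj ?u"
    by (auto simp: inj_on_def fun_eq_iff split: if_splits)
  have expand: "(\<Sum>i\<in>UNIV. fscale (x i) (?u i)) = x" for x :: "'l \<Rightarrow> 'k"
    by (simp add: fun_eq_iff sum_apply fscale_def if_distrib cong: if_cong)
  show "finite_dimensional_vector_space (fscale :: 'k \<Rightarrow> ('l \<Rightarrow> 'k) \<Rightarrow> 'l \<Rightarrow> 'k) (range ?u)"
  proof
    show "finite (range ?u)" by simp
    show "vs.independent (range ?u)"
    proof
      assume "vs.dependent (range ?u)"
      then obtain c where c: "\<exists>v\<in>range ?u. c v \<noteq> 0" "(\<Sum>v\<in>range ?u. fscale (c v) v) = 0"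
        by (auto simp: vs.dependent_finite)
      have "(\<Sum>i\<in>UNIV. fscale (c (?u i)) (?u i)) = 0"
        using c(2) by (simp add: sum.reindex[OF inj])
      then have "c (?u i) = 0" for i
        using expand[of "\<lambda>i. c (?u i)"] by (auto simp: fun_eq_iff)
      with c(1) show False by blast
    qed
    show "vs.span (range ?u) = UNIV"
    proof -
      have "x \<in> vs.span (range ?u)" for x :: "'l \<Rightarrow> 'k"
        by (subst expand[of x, symmetric])
           (rule vs.span_sum, rule vs.span_scale, rule vs.span_base, simp)
      then show ?thesis by blast
    qed
  qed
qed

lemma subspace_zeros: "fscale.subspace (zeros F)"
  unfolding fscale.subspace_def zeros_def
  by (auto simp: form_val_add form_val_fscale)

lemma zero_in_zeros: "(0 :: 'l::finite \<Rightarrow> 'k::field) \<in> zeros F"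
  by (simp add: zeros_def)

lemma zeros_eq_0I: "(\<And>x :: 'l::finite \<Rightarrow> 'k::field. x \<in> zeros F \<Longrightarrow> x = 0) \<Longrightarrow> zeros F = ({0} :: ('l \<Rightarrow> 'k) set)"
  using zero_in_zeros by fastforce

lemma zeros_mono: "F \<subseteq> G \<Longrightarrow> zeros G \<subseteq> zeros F"
  by (auto simp: zeros_def)

abbreviation zdim :: "'k::field itself \<Rightarrow> ('l::finite \<Rightarrow> int) set \<Rightarrow> nat" where
  "zdim _ F \<equiv> fscale.dim (zeros F :: ('l \<Rightarrow> 'k) set)"

lemma sdim_zeros: "sdim (zeros F :: ('l::finite \<Rightarrow> 'k::field) set) = int (zdim TYPE('k) F)"
  using zero_in_zeros[of F] by (auto simp: sdim_def)

lemma zdim_empty: "zdim TYPE('k::field) ({} :: ('l::finite \<Rightarrow> int) set) = CARD('l)"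
proof -
  have "inj (\<lambda>(i::'l) j. if j = i then 1 else (0::'k))"
    by (auto simp: inj_on_def fun_eq_iff split: if_splits)
  then have "card (range (\<lambda>(i::'l) j. if j = i then 1 else (0::'k))) = CARD('l)"
    by (rule card_image)
  then show ?thesis
    unfolding zeros_def by (simp add: fscale.dim_UNIV)
qed

lemma zdim_eq_0_iff:
  "zdim TYPE('k::field) F = 0 \<longleftrightarrow> zeros F = ({0} :: ('l::finite \<Rightarrow> 'k) set)"
  using zero_in_zeros[of F] by auto

lemma sdim_zeros_eq_0_iff:
  "sdim (zeros F :: ('l::finite \<Rightarrow> 'k::field) set) = 0 \<longleftrightarrow> zeros F = ({0} :: ('l \<Rightarrow> 'k) set)"
  unfolding sdim_zeros of_nat_eq_0_iff zdim_eq_0_iff ..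

text \<open>If \<open>a\<close> does not vanish at some zero \<open>v\<close> of \<open>F\<close>,
  every zero of \<open>F\<close> is a multiple of \<open>v\<close> plus a zero of
  \<open>insert a F\<close>. A basis of the smaller space together with \<open>v\<close> therefore
  spans.\<close>

lemma zdim_insert:
  fixes F :: "('l::finite \<Rightarrow> int) set"
  shows "zdim TYPE('k::field) F \<le> zdim TYPE('k) (insert a F) + 1"
proof (cases "zeros F \<subseteq> (zeros (insert a F) :: ('l::finite \<Rightarrow> 'k) set)")
  case True
  then show ?thesis using fscale.dim_subset[OF True] by linarith
next
  case False
  then obtain v :: "'l \<Rightarrow> 'k" where v: "v \<in> zeros F" "form_val a v \<noteq> 0"
    by (auto simp: zeros_def)
  obtain B where B: "B \<subseteq> (zeros (insert a F) :: ('l \<Rightarrow> 'k) set)" "fscale.independent B"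
      "zeros (insert a F) \<subseteq> fscale.span B" "card B = zdim TYPE('k) (insert a F)"
    using fscale.basis_exists by metis
  have fB: "finite B" using B(2) fscale.finiteI_independent by blast
  have "x \<in> fscale.span (insert v B)" if x: "x \<in> zeros F" for x
  proof -
    define c where "c = form_val a x / form_val a v"
    have "x - fscale c v \<in> zeros (insert a F)"
      using x v by (auto simp: zeros_def form_val_diff form_val_fscale c_def)
    then have "x - fscale c v \<in> fscale.span B"
      using B(3) by blast
    then show ?thesis
      by (auto simp: fscale.span_insert)
  qed
  then have "zdim TYPE('k) F \<le> card (insert v B)"
    using fB by (intro fscale.dim_le_card) auto
  also have "\<dots> \<le> zdim TYPE('k) (insert a F) + 1"
    using fB B(4) by (simp add: card_insert_if)
  finally show ?thesis .
qed

lemma zdim_union: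
  "finite E \<Longrightarrow> zdim TYPE('k::field) F \<le> zdim TYPE('k) (F \<union> E) + card E"
proof (induction E rule: finite_induct)
  case (insert a E)
  then show ?case
    using zdim_insert[of "F \<union> E" a, where 'k='k] by auto
qed simp

text \<open>Greedy choice: a form of \<open>E\<close> is kept only if it shrinks the zero space, and
  each kept form lowers the dimension by at least one.\<close>

lemma zeros_reduce:
  assumes "finite E"
  shows "\<exists>E'\<subseteq>E. zeros (F \<union> E') = (zeros (F \<union> E) :: ('l::finite \<Rightarrow> 'k::field) set) \<and>
           card E' + zdim TYPE('k) (F \<union> E) \<le> zdim TYPE('k) F"
  using assms
proof (induction E rule: finite_induct)
  case (insert a E)
  then obtain E' where E': "E' \<subseteq> E" "zeros (F \<union> E') = (zeros (F \<union> E) :: ('l \<Rightarrow> 'k) set)"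
      "card E' + zdim TYPE('k) (F \<union> E) \<le> zdim TYPE('k) F"
    by blast
  have fE: "finite E'" using E'(1) insert.hyps finite_subset by blast
  have sub: "zeros (F \<union> insert a E) \<subseteq> (zeros (F \<union> E) :: ('l \<Rightarrow> 'k) set)"
    by (rule zeros_mono) auto
  show ?case
  proof (cases "zeros (F \<union> insert a E) = (zeros (F \<union> E) :: ('l \<Rightarrow> 'k) set)")
    case True
    then show ?thesis using E' by (intro exI[of _ E']) auto
  next
    case False
    have "zdim TYPE('k) (F \<union> insert a E) \<noteq> zdim TYPE('k) (F \<union> E)"
      using fscale.subspace_dim_equal[OF subspace_zeros subspace_zeros sub] False by fastforce
    then have "zdim TYPE('k) (F \<union> insert a E) < zdim TYPE('k) (F \<union> E)"
      using fscale.dim_subset[OF sub] by linarith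
    moreover have "zeros (F \<union> insert a E') = (zeros (F \<union> insert a E) :: ('l \<Rightarrow> 'k) set)"
      using E'(2) by (auto simp: zeros_def set_eq_iff)
    moreover have "card (insert a E') \<le> card E' + 1"
      using fE by (simp add: card_insert_if)
    ultimately show ?thesis
      using E' by (intro exI[of _ "insert a E'"]) auto
  qed
qed auto

text \<open>A maximal set of independent forms of \<^term>\<open>F\<close> over \<open>\<rat>\<close>, completed by forms of
  \<^term>\<open>A\<close> to a basis, stays a basis over \<^typ>\<open>'k\<close>.\<close>

lemma zdim_le_of_bases:
  fixes A :: "('l::finite \<Rightarrow> int) set"
  assumes "finite A" "F \<subseteq> A" and ess: "zeros A = ({0} :: ('l \<Rightarrow> rat) set)"
    and bases: "\<And>T. T \<subseteq> A \<Longrightarrow> card T = CARD('l) \<Longrightarrow> zeros T = ({0} :: ('l \<Rightarrow> rat) set)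
                  \<Longrightarrow> zeros T = ({0} :: ('l \<Rightarrow> 'k::field) set)"
  shows "zdim TYPE('k) F \<le> zdim TYPE(rat) F"
proof -
  have fF: "finite F" using assms(1,2) finite_subset by blast
  obtain F' where F': "F' \<subseteq> F" "zeros F' = (zeros F :: ('l \<Rightarrow> rat) set)"
      "card F' + zdim TYPE(rat) F \<le> CARD('l)"
    using zeros_reduce[OF fF, of "{}", where 'k=rat] by (auto simp: zdim_empty)
  obtain E where E: "E \<subseteq> A" "zeros (F' \<union> E) = (zeros (F' \<union> A) :: ('l \<Rightarrow> rat) set)"
      "card E + zdim TYPE(rat) (F' \<union> A) \<le> zdim TYPE(rat) F'"
    using zeros_reduce[OF \<open>finite A\<close>, of "F'", where 'k=rat] by blast
  have fE: "finite E" "finite (F' \<union> E)"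
    using E(1) F'(1) fF \<open>finite A\<close> finite_subset by blast+
  have "F' \<union> A = A" using F'(1) assms(2) by blast
  with E(2) ess have z: "zeros (F' \<union> E) = ({0} :: ('l \<Rightarrow> rat) set)" by simp
  have cE: "card E \<le> zdim TYPE(rat) F" using E(3) F'(2) by simp
  \<comment> \<open>The two choices bound the size by l from above; from below, fewer than l forms
    have a common nonzero zero. So \<open>F' \<union> E\<close> is a rational basis of forms and
    \<open>bases\<close> applies.\<close>
  have "card (F' \<union> E) \<le> CARD('l)"
    using card_Un_le[of F' E] F'(3) cE by linarith
  moreover have "CARD('l) \<le> card (F' \<union> E)"
    using zdim_union[OF fE(2), of "{}", where 'k=rat] z by (simp add: zdim_empty)
  ultimately have "zeros (F' \<union> E) = ({0} :: ('l \<Rightarrow> 'k) set)"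
    using bases[of "F' \<union> E"] z E(1) F'(1) assms(2) by auto
  \<comment> \<open>Adding \<open>E\<close> kills all zeros of \<open>F'\<close> over the new field,
    and each form lowers the dimension by at most one.\<close>
  then have "zdim TYPE('k) F' \<le> card E"
    using zdim_union[OF fE(1), of F', where 'k='k] by simp
  moreover have "zdim TYPE('k) F \<le> zdim TYPE('k) F'"
    by (rule fscale.dim_subset[OF zeros_mono[OF F'(1)]])
  ultimately show ?thesis using cE by linarith
qed

text \<open>Over \<open>'k\<close>, at most \<open>zdim F\<close> coordinate forms added to
  \<open>F\<close> leave only the zero vector. By \<open>triv\<close> the same forms do so over
  \<rat>, where each lowers the dimension by at most one.\<close>

lemma zdim_le_of_trivial:
  fixes F :: "('l::finite \<Rightarrow> int) set"
  assumes triv: "\<And>T :: ('l \<Rightarrow> int) set. finite T \<Longrightarrow> zeros (F \<union> T) = ({0} :: ('l \<Rightarrow> 'k::field) set)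
     \<Longrightarrow> zeros (F \<union> T) = ({0} :: ('l \<Rightarrow> rat) set)"
  shows "zdim TYPE(rat) F \<le> zdim TYPE('k) F"
proof -
  define U :: "('l \<Rightarrow> int) set" where "U = range (\<lambda>i j. if j = i then 1 else 0)"
  have fU: "finite U" by (simp add: U_def)
  have val: "form_val (\<lambda>j. if j = i then 1 else 0) x = x i" for i and x :: "'l \<Rightarrow> 'k"
    by (simp add: form_val_def if_distrib if_distribR cong: if_cong)
  have U: "zeros (F \<union> U) = ({0} :: ('l \<Rightarrow> 'k) set)"
  proof -
    have "x = 0" if "x \<in> zeros (F \<union> U)" for x :: "'l \<Rightarrow> 'k"
    proof
      fix i
      have "form_val (\<lambda>j. if j = i then 1 else 0) x = 0"
        using that by (simp add: zeros_def U_def)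
      then show "x i = 0 i" by (simp add: val)
    qed
    then show ?thesis by (rule zeros_eq_0I)
  qed
  obtain E where E: "E \<subseteq> U" "zeros (F \<union> E) = (zeros (F \<union> U) :: ('l \<Rightarrow> 'k) set)"
      "card E + zdim TYPE('k) (F \<union> U) \<le> zdim TYPE('k) F"
    using zeros_reduce[OF fU, of F, where 'k='k] by blast
  have fE: "finite E" using E(1) fU finite_subset by blast
  have "zeros (F \<union> E) = ({0} :: ('l \<Rightarrow> rat) set)"
    using triv[OF fE] E(2) U by simp
  then have "zdim TYPE(rat) F \<le> card E"
    using zdim_union[OF fE, of F, where 'k=rat] by simp
  then show ?thesis using E(3) by linarith
qed

section \<open>Existence of minimal strong Groebner bases\<close>

lemma incseq_subseq_nat:
  fixes s :: "nat \<Rightarrow> nat"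
  shows "\<exists>r :: nat \<Rightarrow> nat. strict_mono r \<and> incseq (s \<circ> r)"
proof -
  obtain r :: "nat \<Rightarrow> nat" where r: "strict_mono r" "monoseq (\<lambda>n. s (r n))"
    using seq_monosub[of s] by blast
  show ?thesis
  proof (cases "incseq (\<lambda>n. s (r n))")
    case True
    then show ?thesis using r(1) by (auto simp: comp_def)
  next
    case False
    then have dec: "decseq (\<lambda>n. s (r n))"
      using r(2) by (simp add: monoseq_iff)
    \<comment> \<open>A decreasing sequence of naturals is constant from the index \<open>N\<close>
      of a least value on, so the shifted tail is also increasing.\<close>
    obtain N where N: "\<And>n. s (r N) \<le> s (r n)"
      using ex_has_least_nat[of "\<lambda>_. True" _ "\<lambda>n. s (r n)"] by auto
    have "s (r (N + n)) = s (r N)" for n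
      using N[of "N + n"] decseqD[OF dec, of N "N + n"] by simp
    then have "strict_mono (\<lambda>n. r (N + n)) \<and> incseq (s \<circ> (\<lambda>n. r (N + n)))"
      using r(1) by (auto simp: strict_mono_def incseq_def)
    then show ?thesis by blast
  qed
qed

text \<open>One further subsequence per index suffices, since subsequences of increasing sequences
  stay increasing.\<close>

lemma incseq_subseq_nat_fun:
  fixes s :: "nat \<Rightarrow> 'a \<Rightarrow> nat"
  assumes "finite J"
  shows "\<exists>r :: nat \<Rightarrow> nat. strict_mono r \<and> (\<forall>j\<in>J. incseq (\<lambda>n. s (r n) j))"
  using assms
proof (induction J rule: finite_induct)
  case empty
  then show ?case using strict_mono_id by auto
next
  case (insert i J)
  then obtain r where r: "strict_mono r" "\<forall>j\<in>J. incseq (\<lambda>n. s (r n) j)" by blast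
  obtain q where q: "strict_mono q" "incseq ((\<lambda>n. s (r n) i) \<circ> q)"
    using incseq_subseq_nat by blast
  have "incseq (\<lambda>n. s (r (q n)) j)" if "j \<in> J" for j
    using r(2) q(1) that by (auto simp: incseq_def strict_mono_less_eq)
  then have "strict_mono (r \<circ> q) \<and> (\<forall>j\<in>insert i J. incseq (\<lambda>n. s ((r \<circ> q) n) j))"
    using q r(1) by (auto simp: comp_def strict_mono_def)
  then show ?case by blast
qed

lemma monom_le_iff:
  fixes s t :: "'l monom"
  shows "(\<exists>u. t = s + u) \<longleftrightarrow> (\<forall>j. Poly_Mapping.lookup s j \<le> Poly_Mapping.lookup t j)"
proof
  assume "\<forall>j. Poly_Mapping.lookup s j \<le> Poly_Mapping.lookup t j"
  \<comment> \<open>Subtraction of exponents is truncated; the hypothesis makes it exact.\<close>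
  then have "t = s + (t - s)"
    by (intro poly_mapping_eqI) (simp add: lookup_add lookup_minus)
  then show "\<exists>u. t = s + u" by blast
qed (auto simp: lookup_add)

text \<open>Dickson's lemma in sequence form. It yields both that term orders are well-founded and
  that minimal bases are finite.\<close>

lemma dickson:
  fixes s :: "nat \<Rightarrow> 'l::finite monom"
  shows "\<exists>r :: nat \<Rightarrow> nat. strict_mono r \<and> (\<forall>m n. m \<le> n \<longrightarrow> (\<exists>u. s (r n) = s (r m) + u))"
  using incseq_subseq_nat_fun[of "UNIV :: 'l set" "\<lambda>n. Poly_Mapping.lookup (s n)"]
  by (auto simp: monom_le_iff incseq_def)

section \<open>Monomial multiples, divisibility of monomials and ideals\<close>

lemma zpoly_induct [case_names zero single add]:
  fixes f :: "'l zpoly"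
  assumes "P 0" "\<And>m c. P (Poly_Mapping.single m c)" "\<And>f g. P f \<Longrightarrow> P g \<Longrightarrow> P (f + g)"
  shows "P f"
proof (induction f rule: update_induct)
  case (update f a b)
  have "Poly_Mapping.update a b f = f + Poly_Mapping.single a b"
    using update.hyps by (intro poly_mapping_eqI)
      (auto simp: lookup_update lookup_add lookup_single when_def in_keys_iff)
  then show ?case using update assms by simp
qed (use assms in auto)

lemma lookup_single_times_add:
  fixes f :: "'l zpoly"
  shows "Poly_Mapping.lookup (Poly_Mapping.single s c * f) (s + u) = c * Poly_Mapping.lookup f u"
  by (induction f rule: zpoly_induct)
     (auto simp: mult_single lookup_single when_def distrib_left lookup_add)

lemma lookup_const_times:
  fixes f :: "'l zpoly"
  shows "Poly_Mapping.lookup (Poly_Mapping.single 0 c * f) u = c * Poly_Mapping.lookup f u"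
  using lookup_single_times_add[of 0 c f u] by simp

lemma keys_single_times:
  fixes f :: "'l zpoly"
  assumes "m \<in> Poly_Mapping.keys (Poly_Mapping.single s c * f)"
  obtains u where "m = s + u" "u \<in> Poly_Mapping.keys f"
  using subsetD[OF keys_mult assms] by (auto split: if_splits)

lemma single_dvd_single_iff:
  fixes s t :: "'l monom" and c d :: int
  assumes "d \<noteq> 0"
  shows "Poly_Mapping.single s c dvd Poly_Mapping.single t d \<longleftrightarrow> (\<exists>u. t = s + u) \<and> c dvd d"
proof
  assume "Poly_Mapping.single s c dvd Poly_Mapping.single t d"
  then obtain f where f: "Poly_Mapping.single t d = Poly_Mapping.single s c * f" by (rule dvdE)
  have "t \<in> Poly_Mapping.keys (Poly_Mapping.single s c * f)"
    using assms by (simp flip: f)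
  then obtain u where u: "t = s + u" by (rule keys_single_times)
  have "d = c * Poly_Mapping.lookup f u"
    using arg_cong[OF f, of "\<lambda>p. Poly_Mapping.lookup p t"] by (simp add: u lookup_single_times_add)
  with u show "(\<exists>u. t = s + u) \<and> c dvd d" by auto
next
  assume "(\<exists>u. t = s + u) \<and> c dvd d"
  then obtain u e where "t = s + u" "d = c * e" unfolding dvd_def by blast
  then have "Poly_Mapping.single t d = Poly_Mapping.single s c * Poly_Mapping.single u e"
    by (simp add: mult_single)
  then show "Poly_Mapping.single s c dvd Poly_Mapping.single t d" by (rule dvdI)
qed

text \<open>Stated by closure instead of generators: finite generation is a consequence of the
  existence of Groebner bases.\<close>

definition is_ideal :: "'l zpoly set \<Rightarrow> bool" where
  "is_ideal I \<longleftrightarrow> 0 \<in> I \<and> (\<forall>f\<in>I. \<forall>g\<in>I. f + g \<in> I) \<and> (\<forall>f\<in>I. \<forall>h. h * f \<in> I)"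

lemma is_idealD:
  assumes "is_ideal I"
  shows "0 \<in> I" "f \<in> I \<Longrightarrow> g \<in> I \<Longrightarrow> f + g \<in> I" "f \<in> I \<Longrightarrow> h * f \<in> I"
  using assms by (auto simp: is_ideal_def)

lemma is_ideal_diff: "is_ideal I \<Longrightarrow> f \<in> I \<Longrightarrow> g \<in> I \<Longrightarrow> f - g \<in> I"
  unfolding is_ideal_def by (metis add_uminus_conv_diff mult_minus1)

lemma is_ideal_ideal_gen: "is_ideal (ideal_gen G)"
proof -
  have "0 \<in> ideal_gen G"
    by (auto simp: ideal_gen_def intro!: exI[of _ "\<lambda>_. 0"])
  moreover have "f + g \<in> ideal_gen G" if "f \<in> ideal_gen G" "g \<in> ideal_gen G" for f g
  proof -
    from that obtain c d where "f = (\<Sum>g\<in>G. c g * g)" "g = (\<Sum>g\<in>G. d g * g)"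
      by (auto simp: ideal_gen_def)
    then have "f + g = (\<Sum>g\<in>G. (c g + d g) * g)"
      by (simp add: distrib_right sum.distrib)
    then show ?thesis unfolding ideal_gen_def by (intro CollectI exI)
  qed
  moreover have "h * f \<in> ideal_gen G" if "f \<in> ideal_gen G" for f h
  proof -
    from that obtain c where "f = (\<Sum>g\<in>G. c g * g)"
      by (auto simp: ideal_gen_def)
    then have "h * f = (\<Sum>g\<in>G. (h * c g) * g)"
      by (simp add: sum_distrib_left mult.assoc)
    then show ?thesis unfolding ideal_gen_def by (intro CollectI exI)
  qed
  ultimately show ?thesis by (simp add: is_ideal_def)
qed

text \<open>Finiteness matters because the sum in \<open>ideal_gen\<close> is 0 by convention over
  an infinite set.\<close>

lemma ideal_gen_base:
  assumes "finite G" "g \<in> G"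
  shows "g \<in> ideal_gen G"
proof -
  have "(\<Sum>h\<in>G. (if h = g then 1 else 0) * h) = (\<Sum>h\<in>G. if h = g then h else 0)"
    by (intro sum.cong) auto
  then have "g = (\<Sum>h\<in>G. (if h = g then 1 else 0) * h)"
    using assms by simp
  then show ?thesis unfolding ideal_gen_def by (intro CollectI exI)
qed

lemma ideal_gen_least:
  assumes "is_ideal I" "G \<subseteq> I"
  shows "ideal_gen G \<subseteq> I"
proof
  fix f assume "f \<in> ideal_gen G"
  then obtain c where f: "f = (\<Sum>g\<in>G. c g * g)" by (auto simp: ideal_gen_def)
  have "(\<Sum>g\<in>H. c g * g) \<in> I" if "H \<subseteq> G" for H
    using that assms by (induction H rule: infinite_finite_induct) (auto simp: is_ideal_def)
  then show "f \<in> I" using f by blast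
qed

section \<open>Term orders, leading data and division\<close>

context
  fixes tord :: "'l::finite monom \<Rightarrow> 'l monom \<Rightarrow> bool"
  assumes ord: "term_order tord"
begin

lemma tord_refl: "tord a a"
  and tord_antisym: "tord a b \<Longrightarrow> tord b a \<Longrightarrow> a = b"
  and tord_trans: "tord a b \<Longrightarrow> tord b c \<Longrightarrow> tord a c"
  and tord_linear: "tord a b \<or> tord b a"
  and tord_zero: "tord 0 a"
  and tord_add: "tord a b \<Longrightarrow> tord (a + c) (b + c)"
  using ord unfolding term_order_def by blast+

lemma tord_add_right: "tord a (a + u)"
  using tord_add[OF tord_zero, of a u] by (simp add: add.commute)

text \<open>By Dickson's lemma a strictly descending chain has a term dividing a later one, yet a
  divisor is never larger than its multiple.\<close>

lemma wf_tord: "wf {(a, b). tord a b \<and> a \<noteq> b}"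
  unfolding wf_iff_no_infinite_down_chain
proof
  assume "\<exists>s. \<forall>i. (s (Suc i), s i) \<in> {(a, b). tord a b \<and> a \<noteq> b}"
  then obtain s where s: "\<And>i. tord (s (Suc i)) (s i)" "\<And>i. s (Suc i) \<noteq> s i" by blast
  have dec: "tord (s (i + k)) (s i)" for i k
    by (induction k) (auto simp: tord_refl intro: tord_trans[OF s(1)])
  obtain r :: "nat \<Rightarrow> nat" where r1: "strict_mono r" "\<And>m n. m \<le> n \<Longrightarrow> \<exists>u. s (r n) = s (r m) + u"
    using dickson[of s] by blast
  obtain u where r: "strict_mono r" "s (r 1) = s (r 0) + u" using r1(1) r1(2)[of 0 1] by auto
  have "r 0 < r 1" using r(1) by (simp add: strict_mono_def)
  \<comment> \<open>Starting the descent at \<open>Suc (r 0)\<close> squeezes \<open>s (r 0)\<close>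
    below \<open>s (Suc (r 0))\<close>, against strictness of that single step.\<close>
  then obtain k where k: "r 1 = Suc (r 0) + k" using less_iff_Suc_add by auto
  have "tord (s (r 0)) (s (r 1))" using r(2) tord_add_right by simp
  then have "tord (s (r 0)) (s (Suc (r 0)))" using dec[of "Suc (r 0)" k] k tord_trans by metis
  then show False using s tord_antisym by blast
qed

lemma tord_min_exists:
  assumes "A \<noteq> {}"
  shows "\<exists>m\<in>A. \<forall>a\<in>A. tord m a"
proof -
  obtain m where m: "m \<in> A" "\<And>a. (a, m) \<in> {(a, b). tord a b \<and> a \<noteq> b} \<Longrightarrow> a \<notin> A"
    using wfE_min'[OF wf_tord assms] by blast
  have "tord m a" if "a \<in> A" for a
    using m(2)[of a] that tord_linear[of m a] tord_refl by auto
  with m(1) show ?thesis by blast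
qed

lemma LT_unique:
  assumes "m \<in> Poly_Mapping.keys f" "\<And>m'. m' \<in> Poly_Mapping.keys f \<Longrightarrow> tord m' m"
  shows "LT tord f = m"
  unfolding LT_def using assms tord_antisym by (intro the_equality) auto

lemma LT_props:
  assumes "f \<noteq> 0"
  shows "LT tord f \<in> Poly_Mapping.keys f" "m \<in> Poly_Mapping.keys f \<Longrightarrow> tord m (LT tord f)"
proof -
  have "\<exists>m\<in>A. \<forall>m'\<in>A. tord m' m" if "finite A" "A \<noteq> {}" for A
    using that
  proof (induction A rule: finite_ne_induct)
    case (singleton x)
    then show ?case using tord_refl by auto
  next
    case (insert x A)
    then show ?case using tord_linear tord_trans tord_refl by (metis insert_iff)
  qed
  then obtain m0 where m0: "m0 \<in> Poly_Mapping.keys f" "\<forall>m'\<in>Poly_Mapping.keys f. tord m' m0"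
    using assms by (metis finite_keys keys_eq_empty)
  then have "LT tord f = m0" by (intro LT_unique) auto
  with m0 show "LT tord f \<in> Poly_Mapping.keys f" "m \<in> Poly_Mapping.keys f \<Longrightarrow> tord m (LT tord f)" by auto
qed

lemma LC_nonzero: "f \<noteq> 0 \<Longrightarrow> LC tord f \<noteq> 0"
  using LT_props(1) by (auto simp: LC_def in_keys_iff)

lemma LM_dvd_LM_iff:
  "g \<noteq> 0 \<Longrightarrow> LM tord f dvd LM tord g \<longleftrightarrow> (\<exists>u. LT tord g = LT tord f + u) \<and> LC tord f dvd LC tord g"
  unfolding LM_def by (rule single_dvd_single_iff) (rule LC_nonzero)

lemma lead_eqI:
  assumes "Poly_Mapping.lookup f t = c" "c \<noteq> 0" "\<And>m. m \<in> Poly_Mapping.keys f \<Longrightarrow> tord m t"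
  shows "f \<noteq> 0" "LT tord f = t" "LC tord f = c"
proof -
  show "f \<noteq> 0" using assms(1,2) by auto
  show "LT tord f = t" using assms by (intro LT_unique) (auto simp: in_keys_iff)
  then show "LC tord f = c" using assms(1) by (simp add: LC_def)
qed

lemma lead_single:
  assumes "c \<noteq> 0"
  shows "Poly_Mapping.single t c \<noteq> 0" "LT tord (Poly_Mapping.single t c) = t"
    "LC tord (Poly_Mapping.single t c) = c"
  using assms by (intro lead_eqI[of "Poly_Mapping.single t c" t c]; auto simp: tord_refl)+

lemma lead_monom_times:
  assumes "f \<noteq> 0"
  shows "Poly_Mapping.single u 1 * f \<noteq> 0"
    "LT tord (Poly_Mapping.single u 1 * f) = LT tord f + u"
    "LC tord (Poly_Mapping.single u 1 * f) = LC tord f"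
proof -
  let ?g = "Poly_Mapping.single u 1 * f"
  have 1: "Poly_Mapping.lookup ?g (LT tord f + u) = LC tord f"
    using lookup_single_times_add[of u 1 f "LT tord f"] by (simp add: LC_def add.commute)
  have 2: "tord m (LT tord f + u)" if "m \<in> Poly_Mapping.keys ?g" for m
    using that
  proof (rule keys_single_times)
    fix v assume "m = u + v" "v \<in> Poly_Mapping.keys f"
    then show ?thesis using LT_props(2)[OF assms] tord_add by (metis add.commute)
  qed
  show "?g \<noteq> 0" "LT tord ?g = LT tord f + u" "LC tord ?g = LC tord f"
    using lead_eqI[OF 1 LC_nonzero[OF assms] 2] by auto
qed

text \<open>Integer combinations of polynomials with a common leading term act on the leading
  coefficients alone unless these cancel. Sign changes, division with remainder and Bezout
  combinations are all instances.\<close>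

lemma lead_lin_comb:
  assumes "f \<noteq> 0" "g \<noteq> 0" "LT tord f = t" "LT tord g = t" "a * LC tord f + b * LC tord g \<noteq> 0"
  defines "h \<equiv> Poly_Mapping.single 0 a * f + Poly_Mapping.single 0 b * g"
  shows "h \<noteq> 0" "LT tord h = t" "LC tord h = a * LC tord f + b * LC tord g"
proof -
  have l: "Poly_Mapping.lookup h m = a * Poly_Mapping.lookup f m + b * Poly_Mapping.lookup g m" for m
    by (simp add: h_def lookup_add lookup_const_times)
  have 1: "Poly_Mapping.lookup h t = a * LC tord f + b * LC tord g"
    using l assms by (simp add: LC_def)
  have 2: "tord m t" if "m \<in> Poly_Mapping.keys h" for m
  proof -
    have "m \<in> Poly_Mapping.keys f \<or> m \<in> Poly_Mapping.keys g" using that l by (auto simp: in_keys_iff)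
    then show ?thesis using LT_props(2) assms by metis
  qed
  show "h \<noteq> 0" "LT tord h = t" "LC tord h = a * LC tord f + b * LC tord g"
    using lead_eqI[OF 1 assms(5) 2] by auto
qed

text \<open>Division algorithm: strong divisibility gives an integral monomial multiple of some
  \<open>g\<close> with the same leading monomial as \<open>f\<close>. Subtracting it leaves 0 or a
  smaller leading term, and the term order is well-founded.\<close>

lemma min_strong_GB_generates:
  assumes I: "is_ideal I" and "finite G" and G: "G \<subseteq> I"
    and red: "\<And>f. f \<in> I \<Longrightarrow> f \<noteq> 0 \<Longrightarrow> \<exists>g\<in>G. g \<noteq> 0 \<and> LM tord g dvd LM tord f"
  shows "ideal_gen G = I"
proof
  show "ideal_gen G \<subseteq> I" by (rule ideal_gen_least[OF I G])
  have "f \<in> I \<Longrightarrow> f \<noteq> 0 \<Longrightarrow> LT tord f = t \<Longrightarrow> f \<in> ideal_gen G" for f t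
  proof (induction t arbitrary: f rule: wf_induct_rule[OF wf_tord])
    case (1 t)
    obtain g u q where g: "g \<in> G" "g \<noteq> 0" "t = LT tord g + u" "LC tord f = LC tord g * q"
      using red[of f] "1.prems" by (auto simp: LM_dvd_LM_iff elim!: dvdE)
    define h where "h = Poly_Mapping.single u q * g"
    have h: "h \<in> ideal_gen G" "h \<in> I"
      unfolding h_def using ideal_gen_base[OF \<open>finite G\<close> g(1)] G g(1)
      by (auto intro!: is_idealD(3) is_ideal_ideal_gen I)
    have ht: "Poly_Mapping.lookup h t = LC tord f"
      using lookup_single_times_add[of u q g "LT tord g"]
      by (simp add: h_def g(3,4) LC_def[of _ g] add.commute mult.commute)
    have hk: "tord m t" if "m \<in> Poly_Mapping.keys h" for m
      using that unfolding h_def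
    proof (rule keys_single_times)
      fix v assume "m = u + v" "v \<in> Poly_Mapping.keys g"
      then show ?thesis using LT_props(2)[OF g(2)] tord_add g(3) by (metis add.commute)
    qed
    have "f - h \<in> ideal_gen G"
    proof (cases "f - h = 0")
      case True
      then show ?thesis using is_idealD(1)[OF is_ideal_ideal_gen, of G] by simp
    next
      case False
      have k: "LT tord (f - h) \<in> Poly_Mapping.keys (f - h)" using LT_props(1)[OF False] .
      then have "LT tord (f - h) \<in> Poly_Mapping.keys f \<or> LT tord (f - h) \<in> Poly_Mapping.keys h"
        by (auto simp: in_keys_iff lookup_minus)
      then have "tord (LT tord (f - h)) t"
        using hk LT_props(2)[OF "1.prems"(2)] "1.prems"(3) by auto
      moreover have "LT tord (f - h) \<noteq> t"
        using k ht "1.prems"(3) by (auto simp: in_keys_iff lookup_minus LC_def)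
      ultimately show ?thesis
        using "1.IH"[of "LT tord (f - h)" "f - h"] False is_ideal_diff[OF I "1.prems"(1) h(2)]
        by auto
    qed
    then have "(f - h) + h \<in> ideal_gen G"
      using h(1) is_ideal_ideal_gen unfolding is_ideal_def by blast
    then show ?case by simp
  qed
  then show "I \<subseteq> ideal_gen G"
    using is_ideal_ideal_gen[of G] by (auto simp: is_ideal_def)
qed

text \<open>\<open>c t\<close> is the positive generator of the ideal of leading coefficients of elements of
  \<open>I\<close> with leading term \<open>t\<close>. It decreases in the divisibility order as \<open>t\<close> grows, and a
  minimal basis has one element for each \<open>t\<close> at which it differs from all \<open>c s\<close>
  with \<open>s\<close> a proper divisor of \<open>t\<close>.\<close>

lemma min_strong_GB_exists:
  assumes I: "is_ideal I"
  shows "\<exists>G. min_strong_GB tord G I"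
proof -
  define T where "T = LT tord ` (I - {0})"
  define L where "L t k \<longleftrightarrow> k > 0 \<and> (\<exists>f\<in>I. f \<noteq> 0 \<and> LT tord f = t \<and> LC tord f = int k)" for t k
  define c where "c t = (LEAST k. L t k)" for t
  have pos: "\<exists>k. L t k \<and> int k = \<bar>LC tord f\<bar>" if f: "f \<in> I" "f \<noteq> 0" "LT tord f = t" for f t
  proof -
    define s where "s = sgn (LC tord f)"
    have s: "s * LC tord f = \<bar>LC tord f\<bar>" unfolding s_def by (simp add: abs_sgn mult.commute)
    \<comment> \<open>The zero summand lets \<open>lead_lin_comb\<close> perform the multiplication
      by the sign \<open>s\<close>.\<close>
    have nz: "s * LC tord f + 0 * LC tord f \<noteq> 0" using s LC_nonzero[OF f(2)] by simp
    note h = lead_lin_comb[OF f(2,2) refl refl nz]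
    have "Poly_Mapping.single 0 s * f + Poly_Mapping.single 0 0 * f \<in> I"
      using I f(1) by (auto simp: is_ideal_def)
    then have "L t (nat \<bar>LC tord f\<bar>)"
      unfolding L_def using h f(3) s LC_nonzero[OF f(2)] by (metis abs_ge_zero add.right_neutral mult_zero_left nat_0_le zero_less_abs_iff zero_less_nat_eq)
    then show ?thesis by (intro exI[of _ "nat \<bar>LC tord f\<bar>"]) auto
  qed
  have Lc: "L t (c t)" if "t \<in> T" for t
    using that pos LeastI[of "L t"] unfolding T_def c_def by blast
  then have "\<forall>t\<in>T. \<exists>f\<in>I. f \<noteq> 0 \<and> LT tord f = t \<and> LC tord f = int (c t)"
    unfolding L_def by blast
  then obtain b where b: "\<And>t. t \<in> T \<Longrightarrow> b t \<in> I" "\<And>t. t \<in> T \<Longrightarrow> b t \<noteq> 0"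
      "\<And>t. t \<in> T \<Longrightarrow> LT tord (b t) = t" "\<And>t. t \<in> T \<Longrightarrow> LC tord (b t) = int (c t)"
    by metis
  have dvd: "int (c t) dvd LC tord f" if f: "f \<in> I" "f \<noteq> 0" "LT tord f = t" for f t
  proof (rule ccontr)
    assume nd: "\<not> int (c t) dvd LC tord f"
    have t: "t \<in> T" using f by (auto simp: T_def)
    have cpos: "c t > 0" using Lc[OF t] by (simp add: L_def)
    \<comment> \<open>Division with remainder: a nonzero remainder would be a leading coefficient at
      \<open>t\<close> smaller than the least one, \<open>c t\<close>.\<close>
    define q where "q = LC tord f div int (c t)"
    have r: "1 * LC tord f + (- q) * LC tord (b t) = LC tord f mod int (c t)"
      using b(4)[OF t] by (simp add: q_def minus_div_mult_eq_mod [symmetric])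
    have "LC tord f mod int (c t) \<noteq> 0" using nd by (simp add: dvd_eq_mod_eq_0)
    then have nz: "1 * LC tord f + (- q) * LC tord (b t) \<noteq> 0" using r by simp
    note h = lead_lin_comb[OF f(2) b(2)[OF t] f(3) b(3)[OF t] nz]
    have "Poly_Mapping.single 0 1 * f + Poly_Mapping.single 0 (- q) * b t \<in> I"
      using I f(1) b(1)[OF t] by (auto simp: is_ideal_def)
    then obtain k where k: "L t k" "int k = \<bar>LC tord f mod int (c t)\<bar>"
      using pos h r by metis
    then have "int k < int (c t)" using cpos by simp
    then show False using k(1) unfolding c_def by (metis not_less_Least of_nat_less_iff)
  qed
  have Tadd: "t + u \<in> T" "c (t + u) dvd c t" if t: "t \<in> T" for t u
  proof -
    let ?f = "Poly_Mapping.single u 1 * b t"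
    have f: "?f \<in> I" using I b(1)[OF t] by (auto simp: is_ideal_def)
    note l = lead_monom_times[OF b(2)[OF t], of u]
    show "t + u \<in> T"
      unfolding T_def using f l b(3)[OF t] by (intro image_eqI[of _ _ ?f]) auto
    show "c (t + u) dvd c t"
      using dvd[OF f l(1)] l b(3,4)[OF t] by simp
  qed
  define B where "B = {t \<in> T. \<forall>s\<in>T. c s = c t \<and> (\<exists>u. t = s + u) \<longrightarrow> s = t}"
  have BT: "B \<subseteq> T" by (auto simp: B_def)
  have finB: "finite B"
  proof (rule ccontr)
    assume "infinite B"
    then obtain s :: "nat \<Rightarrow> 'l monom" where s: "inj s" "range s \<subseteq> B"
      using infinite_countable_subset by blast
    obtain r :: "nat \<Rightarrow> nat" where r: "strict_mono r" "\<And>m n. m \<le> n \<Longrightarrow> \<exists>u. s (r n) = s (r m) + u"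
      using dickson[of s] by blast
    have sT: "s n \<in> T" for n using s(2) BT by blast
    \<comment> \<open>Along the divisibility chain \<open>c\<close> cannot grow, so after the index
      \<open>N\<close> of its minimum it stays equal. Membership in \<open>B\<close> then identifies
      two consecutive terms, against injectivity.\<close>
    obtain N :: nat where N: "\<And>n. c (s (r N)) \<le> c (s (r n))"
      using ex_has_least_nat[of "\<lambda>_. True" _ "\<lambda>n. c (s (r n))"] by auto
    obtain u where u: "s (r (Suc N)) = s (r N) + u" using r(2)[of N "Suc N"] by auto
    have "c (s (r (Suc N))) dvd c (s (r N))" using Tadd(2)[OF sT] u by metis
    then have "c (s (r (Suc N))) \<le> c (s (r N))"
      using Lc[OF sT] by (intro dvd_imp_le) (auto simp: L_def)
    then have "c (s (r N)) = c (s (r (Suc N)))" using N[of "Suc N"] by simp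
    then have "s (r N) = s (r (Suc N))"
      using s(2) u sT[of "r N"] unfolding B_def by blast
    then show False using s(1) r(1) by (metis injD n_not_Suc_n strict_mono_eq)
  qed
  have below: "\<exists>s\<in>B. c s = c t \<and> (\<exists>u. t = s + u)" if t: "t \<in> T" for t
  proof -
    let ?A = "{s \<in> T. c s = c t \<and> (\<exists>u. t = s + u)}"
    have "?A \<noteq> {}" using t by (auto intro: exI[of _ 0])
    \<comment> \<open>A divisor of \<open>s\<close> with the same value of \<open>c\<close> lies
      again in \<open>?A\<close>, so the least element of \<open>?A\<close> belongs to
      \<open>B\<close>.\<close>
    then obtain s where s: "s \<in> ?A" "\<forall>a\<in>?A. tord s a"
      using tord_min_exists[of ?A] by meson
    have "s \<in> B"
      unfolding B_def
    proof (intro CollectI conjI ballI impI)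
      show "s \<in> T" using s by blast
      fix s' assume s': "s' \<in> T" "c s' = c s \<and> (\<exists>u. s = s' + u)"
      then have "s' \<in> ?A" using s(1) by (auto simp: add.assoc)
      then have "tord s s'" using s(2) by blast
      moreover have "tord s' s" using s'(2) tord_add_right by auto
      ultimately show "s' = s" using tord_antisym by blast
    qed
    then show ?thesis using s(1) by blast
  qed
  define G where "G = b ` B"
  have fG: "finite G" using finB by (simp add: G_def)
  have GI: "G \<subseteq> I" "0 \<notin> G" using b(1,2) BT by (auto simp: G_def)
  have red: "\<exists>g\<in>G. LM tord g dvd LM tord f" if f: "f \<in> I" "f \<noteq> 0" for f
  proof -
    have "LT tord f \<in> T" using f by (auto simp: T_def)
    then obtain s u where s: "s \<in> B" "c s = c (LT tord f)" "LT tord f = s + u"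
      using below by blast
    have "LM tord (b s) dvd LM tord f"
      using f s b(3,4)[of s] BT dvd[OF f refl] by (auto simp: LM_dvd_LM_iff)
    then show ?thesis using s(1) by (auto simp: G_def)
  qed
  have gen: "ideal_gen G = I"
    using min_strong_GB_generates[OF I fG GI(1)] red GI(2) by metis
  have min: "\<not> LM tord g dvd LM tord g'" if g: "g \<in> G" "g' \<in> G" "g \<noteq> g'" for g g'
  proof
    assume d: "LM tord g dvd LM tord g'"
    obtain s t where st: "s \<in> B" "t \<in> B" "g = b s" "g' = b t" using g by (auto simp: G_def)
    then have T: "s \<in> T" "t \<in> T" using BT by auto
    \<comment> \<open>The coefficients give \<open>c s dvd c t\<close>, the terms give the converse
      through \<open>Tadd\<close>; the definition of \<open>B\<close> then forces
      \<open>s = t\<close>.\<close>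
    obtain u where u: "t = s + u" and "c s dvd c t"
      using d b(2-4)[OF T(1)] b(2-4)[OF T(2)] by (auto simp: st LM_dvd_LM_iff)
    then have "c s = c t" using Tadd(2)[OF T(1), of u] by (simp add: dvd_antisym)
    then have "s = t" using st(2) T(1) u unfolding B_def by blast
    then show False using g(3) st by simp
  qed
  show ?thesis
    unfolding min_strong_GB_def using fG GI gen red min by (intro exI[of _ G]) blast
qed

end

section \<open>Ideals generated by linear forms\<close>

definition var :: "'l \<Rightarrow> 'l monom" where
  "var i = Poly_Mapping.single i 1"

lemma lookup_var: "Poly_Mapping.lookup (var i) j = (if i = j then 1 else 0)"
  by (simp add: var_def lookup_single when_def)

lemma var_eq_add_iff: "var i = m + var j \<longleftrightarrow> m = 0 \<and> i = j"
proof
  assume eq: "var i = m + var j"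
  have "i = j"
    using arg_cong[OF eq, of "\<lambda>p. Poly_Mapping.lookup p j"]
    by (simp add: lookup_add lookup_var split: if_splits)
  with eq show "m = 0 \<and> i = j" by simp
qed simp

lemma var_eq_iff: "var i = var j \<longleftrightarrow> i = j"
  using var_eq_add_iff[of i 0 j] by simp

lemma lin_poly_var: "lin_poly a = (\<Sum>j\<in>UNIV. Poly_Mapping.single (var j) (a j))"
  by (simp add: lin_poly_def var_def)

lemma lin_poly_diff: "lin_poly (a - b) = lin_poly a - lin_poly b"
  by (simp add: lin_poly_var single_diff sum_subtractf)

lemma lin_poly_mult: "lin_poly (\<lambda>j. c * a j) = Poly_Mapping.single 0 c * lin_poly a"
  by (simp add: lin_poly_var sum_distrib_left mult_single)

lemma lin_poly_unit:
  fixes i :: "'l::finite"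
  shows "lin_poly (\<lambda>j. if j = i then c else 0) = Poly_Mapping.single (var i) c"
proof -
  have "lin_poly (\<lambda>j. if j = i then c else 0)
      = (\<Sum>j\<in>UNIV. if j = i then Poly_Mapping.single (var j) c else 0)"
    unfolding lin_poly_var by (intro sum.cong) auto
  then show ?thesis by simp
qed

definition lin_part :: "'l zpoly \<Rightarrow> 'l \<Rightarrow> int" where
  "lin_part f i = Poly_Mapping.lookup f (var i)"

lemma lookup_zero_times_lin_poly: "Poly_Mapping.lookup (h * lin_poly a) 0 = 0"
proof (rule ccontr)
  assume "Poly_Mapping.lookup (h * lin_poly a) 0 \<noteq> 0"
  then have "0 \<in> Poly_Mapping.keys (h * lin_poly a)" by (simp add: in_keys_iff)
  then obtain m v where m: "0 = m + v" "v \<in> Poly_Mapping.keys (lin_poly a)"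
    using keys_mult by blast
  then obtain j where "v = var j"
    using keys_sum unfolding lin_poly_var by (fastforce split: if_splits)
  with m(1) have "Poly_Mapping.lookup (m + var j) j = 0" by (metis lookup_zero)
  then show False by (simp add: lookup_add lookup_var)
qed

text \<open>A linear form has no constant term, so only the constant term of \<open>h\<close>
  contributes in degree one.\<close>

lemma lin_part_times_lin_poly:
  fixes a :: "'l::finite \<Rightarrow> int"
  shows "lin_part (h * lin_poly a) = (\<lambda>i. Poly_Mapping.lookup h 0 * a i)"
proof
  fix i
  show "lin_part (h * lin_poly a) i = Poly_Mapping.lookup h 0 * a i"
    unfolding lin_part_def
  proof (induction h rule: zpoly_induct)
    case (single m c)
    have "Poly_Mapping.lookup (Poly_Mapping.single m c * lin_poly a) (var i)
        = (\<Sum>j\<in>UNIV. if j = i then c * a j when m = 0 else 0)"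
      unfolding lin_poly_var sum_distrib_left lookup_sum mult_single
      by (intro sum.cong) (auto simp: lookup_single when_def var_eq_add_iff eq_commute[of "_ + _" "var i"])
    then show ?case by (simp add: lookup_single when_def)
  qed (auto simp: distrib_right lookup_add)
qed

text \<open>The linear part of a combination of the forms is an integral combination of their
  coefficient vectors. The vanishing constant term shows that 1 is never a leading term in the
  ideal.\<close>

lemma ideal_lin_poly_props:
  fixes F :: "('l::finite \<Rightarrow> int) set" and x :: "'l \<Rightarrow> 'k::field"
  assumes f: "f \<in> ideal_gen (lin_poly ` F)"
  shows "Poly_Mapping.lookup f 0 = 0"
    and "x \<in> zeros F \<Longrightarrow> form_val (lin_part f) x = 0"
proof -
  obtain c where f: "f = (\<Sum>g\<in>lin_poly ` F. c g * g)"
    using f by (auto simp: ideal_gen_def)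
  have "Poly_Mapping.lookup (c g * g) 0 = 0" if "g \<in> lin_poly ` F" for g
    using that lookup_zero_times_lin_poly by blast
  then show "Poly_Mapping.lookup f 0 = 0" by (simp add: f lookup_sum)
  assume x: "x \<in> zeros F"
  have add: "lin_part (p + q) = lin_part p + lin_part q" for p q :: "'l zpoly"
    by (simp add: lin_part_def fun_eq_iff lookup_add)
  have "form_val (lin_part (\<Sum>g\<in>H. c g * g)) x = 0" if "H \<subseteq> lin_poly ` F" for H
    using that
  proof (induction H rule: infinite_finite_induct)
    case (insert g H)
    then obtain a where a: "a \<in> F" "g = lin_poly a" by blast
    have "form_val (lin_part (c g * g)) x = of_int (Poly_Mapping.lookup (c g) 0) * form_val a x"
      by (simp add: a(2) lin_part_times_lin_poly form_val_mult_left)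
    moreover have "form_val (lin_part (\<Sum>g\<in>insert g H. c g * g)) x
        = form_val (lin_part (c g * g)) x + form_val (lin_part (\<Sum>g\<in>H. c g * g)) x"
      by (simp only: sum.insert[OF insert.hyps] add form_val_add_left)
    ultimately show ?case
      using insert x a(1) by (simp add: zeros_def)
  qed (auto simp: lin_part_def form_val_def)
  then show "form_val (lin_part f) x = 0" using f by blast
qed

text \<open>Elimination: \<open>M\<close> is a lattice, saturated with respect to the integers invertible in \<^typ>\<open>'k\<close>.
  If some \<open>m \<in> M\<close> has \<open>j\<close>-th coordinate nonzero in \<^typ>\<open>'k\<close>, the zeros of \<open>M\<close> project bijectively
  to those of \<open>{v \<in> M. v j = 0}\<close>.\<close>

lemma saturated_lattice_full:
  fixes M :: "('l::finite \<Rightarrow> int) set"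
  assumes "finite J"
    and "0 \<in> M"
    and "\<And>v w. v \<in> M \<Longrightarrow> w \<in> M \<Longrightarrow> v - w \<in> M"
    and "\<And>v c. v \<in> M \<Longrightarrow> (\<lambda>i. c * v i) \<in> M"
    and "\<And>v d. (of_int d :: 'k::field) \<noteq> 0 \<Longrightarrow> (\<lambda>i. d * v i) \<in> M \<Longrightarrow> v \<in> M"
    and "\<And>v i. v \<in> M \<Longrightarrow> i \<notin> J \<Longrightarrow> v i = 0"
    and "\<And>x :: 'l \<Rightarrow> 'k. x \<in> zeros M \<Longrightarrow> (\<forall>i. i \<notin> J \<longrightarrow> x i = 0) \<Longrightarrow> x = 0"
    and "\<And>i. i \<notin> J \<Longrightarrow> v i = 0"
  shows "v \<in> M"
  using assms
proof (induction J arbitrary: M v rule: finite_induct)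
  case empty
  then have "v = 0" by (simp add: fun_eq_iff)
  then show ?case using empty.prems(1) by metis
next
  case (insert j J)
  note diff = insert.prems(2) and scale = insert.prems(3) and sat = insert.prems(4)
    and supp = insert.prems(5) and triv = insert.prems(6) and v = insert.prems(7)
  define e where "e c = (\<lambda>i. if i = j then c else (0::int))" for c
  have "\<exists>m\<in>M. (of_int (m j) :: 'k) \<noteq> 0"
  proof (rule ccontr)
    assume c: "\<not> ?thesis"
    \<comment> \<open>If all \<open>j\<close>-th coordinates vanished in \<open>'k\<close>, this
      unit vector would be a nonzero zero of \<open>M\<close> supported on
      \<open>insert j J\<close>.\<close>
    let ?x = "\<lambda>i. if i = j then 1 else (0::'k)"
    have "?x \<in> zeros M" using c by (auto simp: zeros_def form_val_unit)
    then have "?x = 0" using triv[of ?x] by auto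
    from fun_cong[OF this, of j] show False by simp
  qed
  then obtain m where m: "m \<in> M" "(of_int (m j) :: 'k) \<noteq> 0" by (elim bexE)
  define M' where "M' = {w \<in> M. w j = 0}"
  have full: "w \<in> M" if w: "\<And>i. i \<notin> J \<Longrightarrow> w i = 0" for w
  proof -
    have "w \<in> M'"
    proof (rule insert.IH)
      show "0 \<in> M'" using insert.prems(1) unfolding M'_def by (intro CollectI conjI) (assumption, simp)
    next
      fix v i assume "v \<in> M'" "i \<notin> J"
      then show "v i = 0" using supp by (cases "i = j") (auto simp: M'_def)
    next
      fix x :: "'l \<Rightarrow> 'k"
      assume x: "x \<in> zeros M'" "\<forall>i. i \<notin> J \<longrightarrow> x i = 0"
      \<comment> \<open>Changing only coordinate \<open>j\<close> makes \<open>m\<close> vanish at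
        \<open>y\<close>, while forms of \<open>M'\<close> do not see the change.\<close>
      define y where "y = x - (\<lambda>i. if i = j then form_val m x / of_int (m j) else 0)"
      have ym: "form_val m y = 0"
        using m(2) by (simp add: y_def form_val_diff form_val_unit)
      have "form_val u y = 0" if u: "u \<in> M" for u
      proof -
        \<comment> \<open>Fraction-free elimination of the \<open>j\<close>-th coordinate of
          \<open>u\<close> by means of \<open>m\<close>.\<close>
        let ?w = "(\<lambda>i. m j * u i) - (\<lambda>i. u j * m i)"
        have "?w \<in> M" by (intro diff scale u m(1))
        then have "?w \<in> M'" by (simp add: M'_def)
        then have 1: "form_val ?w x = 0" using x(1) by (simp add: zeros_def)
        have "form_val ?w y = 0"
          using 1 by (simp add: y_def form_val_diff form_val_unit)
        then have "of_int (m j) * form_val u y = 0"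
          using ym by (simp add: form_val_diff_left form_val_mult_left)
        then show ?thesis using m(2) by simp
      qed
      then have "y \<in> zeros M" by (simp add: zeros_def)
      moreover have "\<forall>i. i \<notin> insert j J \<longrightarrow> y i = 0" using x(2) by (auto simp: y_def)
      ultimately have "y = 0" using triv by blast
      show "x = 0"
      proof
        fix i
        show "x i = 0 i"
          using fun_cong[OF \<open>y = 0\<close>, of i] x(2) insert.hyps(2)
          by (cases "i = j") (auto simp: y_def)
      qed
    next
      fix a b assume ab: "a \<in> M'" "b \<in> M'"
      then have "a - b \<in> M" by (intro diff) (auto simp: M'_def)
      then show "a - b \<in> M'" using ab unfolding M'_def by (intro CollectI conjI) auto
    next
      fix a c assume "a \<in> M'"
      then show "(\<lambda>i. c * a i) \<in> M'" using scale[of a c] by (simp add: M'_def)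
    next
      fix a d assume d: "(of_int d :: 'k) \<noteq> 0" "(\<lambda>i. d * a i) \<in> M'"
      then have "d \<noteq> 0" by auto
      with d show "a \<in> M'" using sat[of d a] by (simp add: M'_def)
    qed (use w in auto)
    then show ?thesis by (simp add: M'_def)
  qed
  have em: "e (m j) \<in> M"
  proof -
    have "m - e (m j) \<in> M" using full[of "m - e (m j)"] supp[OF m(1)] by (auto simp: e_def)
    from diff[OF m(1) this] show ?thesis by (simp only: diff_diff_eq2 add_diff_cancel_left')
  qed
  have "e (v j) \<in> M"
  proof -
    \<comment> \<open>Saturation allows the factor \<open>m j\<close> to be cancelled, leaving
      \<open>e (v j)\<close>, which differs from \<open>v\<close> by a vector supported on
      \<open>J\<close>.\<close>
    have "(\<lambda>i. v j * e (m j) i) \<in> M" by (rule scale[OF em])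
    moreover have "(\<lambda>i. v j * e (m j) i) = (\<lambda>i. m j * e (v j) i)" by (auto simp: e_def)
    ultimately show ?thesis using sat[OF m(2), of "e (v j)"] by simp
  qed
  moreover have "e (v j) - v \<in> M" using full[of "e (v j) - v"] v by (auto simp: e_def)
  ultimately have "e (v j) - (e (v j) - v) \<in> M" by (rule diff)
  then show ?case by (simp only: diff_diff_eq2 add_diff_cancel_left')
qed

lemma var_multiple_in_ideal:
  fixes F :: "('l::finite \<Rightarrow> int) set"
  assumes "zeros F = ({0} :: ('l \<Rightarrow> 'k::field) set)" and "finite F"
  shows "\<exists>d. (of_int d :: 'k) \<noteq> 0 \<and> Poly_Mapping.single (var i) d \<in> ideal_gen (lin_poly ` F)"
proof -
  let ?I = "ideal_gen (lin_poly ` F)"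
  note I = is_ideal_ideal_gen[of "lin_poly ` F"]
  \<comment> \<open>The integral vectors in the localised ideal, with the denominator
    \<open>d\<close> cleared. Elimination shows that \<open>M\<close> contains every unit
    vector.\<close>
  define M where "M = {v. \<exists>d. (of_int d :: 'k) \<noteq> 0 \<and> lin_poly (\<lambda>j. d * v j) \<in> ?I}"
  have FM: "F \<subseteq> M"
  proof
    fix a assume "a \<in> F"
    then have "lin_poly (\<lambda>j. 1 * a j) \<in> ?I"
      using ideal_gen_base[of "lin_poly ` F" "lin_poly a"] assms(2) by simp
    then show "a \<in> M" unfolding M_def by (intro CollectI exI[of _ 1]) simp
  qed
  have "(\<lambda>j. if j = i then 1 else 0) \<in> M"
  proof (rule saturated_lattice_full[where 'k='k and J=UNIV])
    have "lin_poly (\<lambda>j. 1 * (0 :: 'l \<Rightarrow> int) j) \<in> ?I"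
      using is_idealD(1)[OF I] by (simp add: lin_poly_def)
    then show "0 \<in> M"
      unfolding M_def by (intro CollectI exI[of _ 1] conjI) (simp, assumption)
  next
    fix v w assume "v \<in> M" "w \<in> M"
    then obtain d e where d: "(of_int d :: 'k) \<noteq> 0" "lin_poly (\<lambda>j. d * v j) \<in> ?I"
        and e: "(of_int e :: 'k) \<noteq> 0" "lin_poly (\<lambda>j. e * w j) \<in> ?I"
      by (auto simp: M_def)
    have eq: "(\<lambda>j. (d * e) * (v - w) j) = (\<lambda>j. e * (d * v j)) - (\<lambda>j. d * (e * w j))"
      by (auto simp: algebra_simps)
    have "lin_poly (\<lambda>j. (d * e) * (v - w) j) \<in> ?I"
      unfolding eq lin_poly_diff lin_poly_mult[of e "\<lambda>j. d * v j"] lin_poly_mult[of d "\<lambda>j. e * w j"]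
      by (intro is_ideal_diff[OF I] is_idealD(3)[OF I] d(2) e(2))
    then show "v - w \<in> M"
      unfolding M_def using d(1) e(1) by (intro CollectI exI[of _ "d * e"] conjI) simp_all
  next
    fix v c assume "v \<in> M"
    then obtain d where d: "(of_int d :: 'k) \<noteq> 0" "lin_poly (\<lambda>j. d * v j) \<in> ?I"
      by (auto simp: M_def)
    have eq: "(\<lambda>j. d * (c * v j)) = (\<lambda>j. c * (d * v j))" by (auto simp: algebra_simps)
    have "lin_poly (\<lambda>j. d * (c * v j)) \<in> ?I"
      unfolding eq lin_poly_mult[of c] by (intro is_idealD(3)[OF I] d(2))
    then show "(\<lambda>j. c * v j) \<in> M" unfolding M_def using d(1) by (intro CollectI exI[of _ d] conjI)
  next
    fix v d assume d: "(of_int d :: 'k) \<noteq> 0" "(\<lambda>j. d * v j) \<in> M"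
    then obtain e where e: "(of_int e :: 'k) \<noteq> 0" "lin_poly (\<lambda>j. e * (d * v j)) \<in> ?I"
      by (auto simp: M_def)
    then show "v \<in> M"
      unfolding M_def using d(1) by (intro CollectI exI[of _ "e * d"]) (simp add: mult.assoc)
  next
    fix x :: "'l \<Rightarrow> 'k" assume "x \<in> zeros M"
    then show "x = 0" using zeros_mono[OF FM] assms(1) by blast
  qed auto
  then obtain d where d: "(of_int d :: 'k) \<noteq> 0" "lin_poly (\<lambda>j. d * (if j = i then 1 else 0)) \<in> ?I"
    by (auto simp: M_def)
  have "(\<lambda>j. d * (if j = i then 1 else 0)) = (\<lambda>j. if j = i then d else 0)" by auto
  with d show ?thesis by (auto simp: lin_poly_unit)
qed

text \<open>An integer nonzero in \<open>'k\<close> is nonzero, so each multiple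
  \<open>d x_i\<close> in the ideal, evaluated at a rational zero, forces its \<open>i\<close>-th
  coordinate to vanish.\<close>

lemma zeros_trivial_rat:
  fixes F :: "('l::finite \<Rightarrow> int) set"
  assumes "zeros F = ({0} :: ('l \<Rightarrow> 'k::field) set)" and "finite F"
  shows "zeros F = ({0} :: ('l \<Rightarrow> rat) set)"
proof -
  have "x i = 0" if x: "x \<in> zeros F" for x :: "'l \<Rightarrow> rat" and i
  proof -
    have "\<exists>d. (of_int d :: 'k) \<noteq> 0 \<and> Poly_Mapping.single (var i) d \<in> ideal_gen (lin_poly ` F)"
      by (rule var_multiple_in_ideal[OF assms])
    then obtain d where d: "(of_int d :: 'k) \<noteq> 0" "Poly_Mapping.single (var i) d \<in> ideal_gen (lin_poly ` F)"
      by (elim exE conjE)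
    have "lin_part (Poly_Mapping.single (var i) d) = (\<lambda>j. if j = i then d else 0)"
      by (auto simp: lin_part_def lookup_single when_def var_eq_iff)
    then have "of_int d * x i = 0"
      using ideal_lin_poly_props(2)[OF d(2) x] by (simp add: form_val_def if_distrib if_distribR cong: if_cong)
    moreover have "d \<noteq> 0" using d(1) by auto
    ultimately show ?thesis by simp
  qed
  then have "x = 0" if "x \<in> zeros F" for x :: "'l \<Rightarrow> rat"
    using that by (auto simp: fun_eq_iff)
  then show ?thesis by (rule zeros_eq_0I)
qed

section \<open>Lucky primes and trivial zeros modulo p\<close>

lemma of_int_mod_ring_eq_0_iff:
  "(of_int c :: 'p::prime_card mod_ring) = 0 \<longleftrightarrow> int CARD('p) dvd c"
  using of_int_eq_0_iff_char_dvd[of c, where 'a="'p mod_ring"] by simp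

lemma min_strong_GBD:
  assumes "min_strong_GB tord G I"
  shows "g \<in> G \<Longrightarrow> g \<in> I" "g \<in> G \<Longrightarrow> g \<noteq> 0"
    and "f \<in> I \<Longrightarrow> f \<noteq> 0 \<Longrightarrow> \<exists>g\<in>G. LM tord g dvd LM tord f"
    and "g \<in> G \<Longrightarrow> g' \<in> G \<Longrightarrow> LM tord g dvd LM tord g' \<Longrightarrow> g = g'"
  using assms unfolding min_strong_GB_def by blast+

lemma zeros_trivial_of_lucky:
  fixes F :: "('l::finite \<Rightarrow> int) set"
  assumes ord: "term_order tord" and "finite F" and rat: "zeros F = ({0} :: ('l \<Rightarrow> rat) set)"
    and lucky: "sigma_lucky tord CARD('p) (ideal_gen (lin_poly ` F))"
  shows "zeros F = ({0} :: ('l \<Rightarrow> 'p::prime_card mod_ring) set)"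
proof -
  let ?I = "ideal_gen (lin_poly ` F)"
  obtain G where G: "min_strong_GB tord G ?I"
    using min_strong_GB_exists[OF ord is_ideal_ideal_gen] by blast
  have "x = 0" if x: "x \<in> zeros F" for x :: "'l \<Rightarrow> 'p mod_ring"
  proof (rule ccontr)
    assume "x \<noteq> 0"
    then have "{var i | i. x i \<noteq> 0} \<noteq> {}" by (auto simp: fun_eq_iff)
    \<comment> \<open>The least variable in the support of \<open>x\<close>: a form with leading
      term \<open>var i\<close> otherwise involves only smaller variables, where \<open>x\<close> is
      0.\<close>
    from tord_min_exists[OF ord this] obtain i
      where i: "x i \<noteq> 0" "\<And>j. x j \<noteq> 0 \<Longrightarrow> tord (var i) (var j)"
      by blast
    obtain d where d: "(of_int d :: rat) \<noteq> 0" "Poly_Mapping.single (var i) d \<in> ?I"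
      using var_multiple_in_ideal[OF rat \<open>finite F\<close>, of i] by (elim exE conjE)
    have "d \<noteq> 0" using d(1) by simp
    note ls = lead_single[OF ord this, of "var i"]
    obtain g where g: "g \<in> G" "LM tord g dvd LM tord (Poly_Mapping.single (var i) d)"
      using min_strong_GBD(3)[OF G d(2) ls(1)] by blast
    note gI = min_strong_GBD(1,2)[OF G g(1)]
    obtain u where u: "var i = LT tord g + u"
      using g(2) LM_dvd_LM_iff[OF ord ls(1)] ls(2) by auto
    have "LT tord g \<noteq> 0"
      using LT_props(1)[OF ord gI(2)] ideal_lin_poly_props(1)[OF gI(1)] by (auto simp: in_keys_iff)
    \<comment> \<open>The only divisors of \<open>var i\<close> are 1 and itself, and 1 has just
      been excluded.\<close>
    have LT: "LT tord g = var i"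
    proof -
      obtain j where "Poly_Mapping.lookup (LT tord g) j \<noteq> 0"
        using \<open>LT tord g \<noteq> 0\<close> by (metis lookup_zero poly_mapping_eqI)
      then obtain w where w: "LT tord g = var j + w"
        using monom_le_iff[of "LT tord g" "var j"] by (auto simp: lookup_var)
      then have "var i = (w + u) + var j" using u by (simp add: ac_simps)
      then have wu: "w + u = 0" "i = j" using var_eq_add_iff by metis+
      have "Poly_Mapping.lookup w k = 0" for k
        using arg_cong[OF wu(1), of "\<lambda>p. Poly_Mapping.lookup p k"] by (simp add: lookup_add)
      then have "w = 0" by (intro poly_mapping_eqI) simp
      then show ?thesis using w wu(2) by simp
    qed
    have ndvd: "\<not> int CARD('p) dvd LC tord g"
      using lucky G g(1) by (auto simp: sigma_lucky_def)
    have "lin_part g j = 0" if "j \<noteq> i" "x j \<noteq> 0" for j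
    proof (rule ccontr)
      assume "lin_part g j \<noteq> 0"
      then have "tord (var j) (var i)"
        using LT_props(2)[OF ord gI(2), of "var j"] LT by (simp add: lin_part_def in_keys_iff)
      then have "var j = var i" using i(2)[OF that(2)] tord_antisym[OF ord] by blast
      then show False using that(1) by (simp add: var_eq_iff)
    qed
    then have "form_val (lin_part g) x = (\<Sum>j\<in>UNIV. if j = i then of_int (lin_part g j) * x j else 0)"
      unfolding form_val_def by (intro sum.cong) auto
    then have "of_int (lin_part g i) * x i = 0"
      using ideal_lin_poly_props(2)[OF gI(1) x] by simp
    moreover have "lin_part g i = LC tord g" by (simp add: lin_part_def LC_def LT)
    ultimately show False using i(1) ndvd by (simp add: of_int_mod_ring_eq_0_iff)
  qed
  then show ?thesis by (rule zeros_eq_0I)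
qed

lemma lucky_of_zeros_trivial:
  fixes F :: "('l::finite \<Rightarrow> int) set"
  assumes ord: "term_order tord" and "finite F"
    and triv: "zeros F = ({0} :: ('l \<Rightarrow> 'p::prime_card mod_ring) set)"
  shows "sigma_lucky tord CARD('p) (ideal_gen (lin_poly ` F))"
  unfolding sigma_lucky_def
proof (intro allI impI ballI notI)
  let ?I = "ideal_gen (lin_poly ` F)"
  note I = is_ideal_ideal_gen[of "lin_poly ` F"]
  fix G g assume G: "min_strong_GB tord G ?I" and g: "g \<in> G" and dvd: "int CARD('p) dvd LC tord g"
  note gI = min_strong_GBD(1,2)[OF G g]
  have "LT tord g \<noteq> 0"
    using LT_props(1)[OF ord gI(2)] ideal_lin_poly_props(1)[OF gI(1)] by (auto simp: in_keys_iff)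
  then obtain i where "Poly_Mapping.lookup (LT tord g) i \<noteq> 0"
    by (metis lookup_zero poly_mapping_eqI)
  then obtain u where u: "LT tord g = var i + u"
    using monom_le_iff[of "LT tord g" "var i"] by (auto simp: lookup_var)
  obtain d where d: "(of_int d :: 'p mod_ring) \<noteq> 0" "Poly_Mapping.single (var i) d \<in> ?I"
    using var_multiple_in_ideal[OF triv \<open>finite F\<close>, of i] by (elim exE conjE)
  have d0: "d \<noteq> 0" using d(1) by auto
  define h where "h = Poly_Mapping.single u 1 * Poly_Mapping.single (var i) d"
  have hI: "h \<in> ?I" unfolding h_def by (rule is_idealD(3)[OF I d(2)])
  have "h = Poly_Mapping.single (LT tord g) d" by (simp add: h_def mult_single u add.commute)
  then have h: "h \<noteq> 0" "LT tord h = LT tord g" "LC tord h = d" using lead_single[OF ord d0] by auto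
  \<comment> \<open>The combination \<open>f\<close> keeps the leading term of \<open>g\<close> with
    the gcd as coefficient, so its leading monomial divides that of \<open>g\<close>. The basis
    element reducing \<open>f\<close> is therefore \<open>g\<close> itself, whence
    \<open>LC tord g\<close> divides \<open>d\<close>.\<close>
  obtain a b where ab: "a * LC tord g + b * d = gcd (LC tord g) d"
    using bezout_int by blast
  have nz: "a * LC tord g + b * LC tord h \<noteq> 0" using ab h(3) d0 by simp
  note k = lead_lin_comb[OF ord gI(2) h(1) refl h(2) nz]
  define f where "f = Poly_Mapping.single 0 a * g + Poly_Mapping.single 0 b * h"
  have fI: "f \<in> ?I"
    unfolding f_def by (intro is_idealD(2)[OF I] is_idealD(3)[OF I] gI(1) hI)
  have f: "f \<noteq> 0" "LT tord f = LT tord g" "LC tord f = gcd (LC tord g) d"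
    using k ab h(3) by (auto simp: f_def)
  obtain g' where g': "g' \<in> G" "LM tord g' dvd LM tord f"
    using min_strong_GBD(3)[OF G fI f(1)] by blast
  have "LM tord f dvd LM tord g"
    using f by (auto simp: LM_dvd_LM_iff[OF ord gI(2)] intro: exI[of _ 0])
  then have "g' = g" using min_strong_GBD(4)[OF G g'(1) g] g'(2) dvd_trans by blast
  then have "LC tord g dvd gcd (LC tord g) d"
    using g'(2) f by (auto simp: LM_dvd_LM_iff[OF ord f(1)])
  then have "int CARD('p) dvd d" using dvd by (meson dvd_trans gcd_dvd2)
  then show False using d(1) by (simp add: of_int_mod_ring_eq_0_iff)
qed

section \<open>Goodness from equality of dimensions\<close>

lemma hyp_subset_imp_eq:
  fixes a b :: "'l::finite \<Rightarrow> int"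
  assumes "hyp a \<subseteq> (hyp b :: ('l \<Rightarrow> rat) set)" "\<exists>j. a j \<noteq> 0" "\<exists>j. b j \<noteq> 0"
  shows "hyp a = (hyp b :: ('l \<Rightarrow> rat) set)"
proof -
  obtain v where v: "a v \<noteq> 0" using assms(2) by blast
  have cross: "a v * b w = b v * a w" for w
  proof -
    \<comment> \<open>A zero of \<open>a\<close> supported on \<open>v\<close> and \<open>w\<close>;
      the value of \<open>b\<close> there is a 2 by 2 minor, so all minors through column
      \<open>v\<close> vanish.\<close>
    define x :: "'l \<Rightarrow> rat" where
      "x = (\<lambda>j. if j = w then of_int (a v) else 0) - (\<lambda>j. if j = v then of_int (a w) else 0)"
    have "x \<in> hyp a" by (simp add: mem_hyp x_def form_val_diff form_val_unit mult.commute)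
    then have "form_val b x = 0" using assms(1) by (auto simp: mem_hyp)
    then have "of_int (a v * b w) = (of_int (b v * a w) :: rat)"
      by (simp add: x_def form_val_diff form_val_unit mult.commute)
    then show ?thesis by (simp only: of_int_eq_iff)
  qed
  have "b v \<noteq> 0" using cross assms(3) v by (metis mult_eq_0_iff)
  have "of_int (a v) * form_val b x = of_int (b v) * form_val a x" for x :: "'l \<Rightarrow> rat"
    using cross by (simp flip: form_val_mult_left)
  then have "form_val b x = 0 \<longleftrightarrow> form_val a x = 0" for x :: "'l \<Rightarrow> rat"
    using v \<open>b v \<noteq> 0\<close> by (metis mult_eq_0_iff of_int_eq_0_iff)
  then show ?thesis by (auto simp: mem_hyp)
qed

lemma good_of_comb_equiv:
  fixes \<alpha> :: "nat \<Rightarrow> 'l::finite \<Rightarrow> int"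
  assumes arr: "arrangement n \<alpha>" and ce: "comb_equiv n \<alpha> TYPE('p::prime_card)"
  shows "good n \<alpha> TYPE('p)"
  unfolding good_def
proof (intro allI impI notI)
  fix i j assume ij: "i < j \<and> j < n"
  assume "\<exists>c::'p mod_ring. \<forall>v. of_int (\<alpha> i v) = c * of_int (\<alpha> j v)"
  then obtain c :: "'p mod_ring" where c: "\<And>v. of_int (\<alpha> i v) = c * of_int (\<alpha> j v)" by blast
  have "form_val (\<alpha> i) x = c * form_val (\<alpha> j) x" for x
    by (simp add: form_val_def c sum_distrib_left mult.assoc)
  \<comment> \<open>Modulo p the \<open>i\<close>-th equation is redundant. Equality of dimensions
    carries this to \<rat>, where it makes the two hyperplanes coincide.\<close>
  then have eq: "zeros {\<alpha> i, \<alpha> j} = (zeros {\<alpha> j} :: ('l \<Rightarrow> 'p mod_ring) set)"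
    by (auto simp: zeros_def)
  have dim: "zdim TYPE(rat) (\<alpha> ` S) = zdim TYPE('p mod_ring) (\<alpha> ` S)"
    if "S \<subseteq> {..<n}" "S \<noteq> {}" for S
    using ce that by (auto simp: comb_equiv_def inter_hyp_eq_zeros sdim_zeros)
  have "zdim TYPE(rat) {\<alpha> i, \<alpha> j} = zdim TYPE(rat) {\<alpha> j}"
    using dim[of "{i, j}"] dim[of "{j}"] ij eq by simp
  moreover have "zeros {\<alpha> i, \<alpha> j} \<subseteq> (zeros {\<alpha> j} :: ('l \<Rightarrow> rat) set)" by (rule zeros_mono) auto
  ultimately have "zeros {\<alpha> i, \<alpha> j} = (zeros {\<alpha> j} :: ('l \<Rightarrow> rat) set)"
    using fscale.subspace_dim_equal[OF subspace_zeros subspace_zeros] by (metis order_refl)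
  then have "hyp (\<alpha> j) \<subseteq> (hyp (\<alpha> i) :: ('l \<Rightarrow> rat) set)"
    by (auto simp: zeros_def mem_hyp set_eq_iff)
  then have "hyp (\<alpha> j) = (hyp (\<alpha> i) :: ('l \<Rightarrow> rat) set)"
    using arr ij by (intro hyp_subset_imp_eq) (auto simp: arrangement_def)
  then show False using arr ij unfolding arrangement_def by (metis less_trans nat_neq_iff)
qed

theorem theorem4p14:
  fixes n :: nat
    and \<alpha> :: "nat \<Rightarrow> 'l::finite \<Rightarrow> int"
    and tord :: "'l monom \<Rightarrow> 'l monom \<Rightarrow> bool"
  assumes "arrangement n \<alpha>"
    and "term_order tord"
  shows "(good n \<alpha> TYPE('p::prime_card) \<and> sk_lucky tord CARD('l) CARD('p) n \<alpha>)
         \<longleftrightarrow> comb_equiv n \<alpha> TYPE('p)"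
proof
  assume ce: "comb_equiv n \<alpha> TYPE('p)"
  have "sk_lucky tord CARD('l) CARD('p) n \<alpha>"
    unfolding sk_lucky_def
  proof (intro allI impI, elim conjE)
    fix S assume S: "S \<subseteq> {..<n}" "card S = CARD('l)"
      and "int CARD('l) - sdim (inter_hyp \<alpha> S :: ('l \<Rightarrow> rat) set) = int CARD('l)"
    then have "sdim (inter_hyp \<alpha> S :: ('l \<Rightarrow> rat) set) = 0" by simp
    \<comment> \<open>\<open>comb_equiv\<close> speaks of nonempty index sets only; here l is
      positive because types are inhabited.\<close>
    moreover have "S \<noteq> {}" using S(2) by auto
    ultimately have "sdim (inter_hyp \<alpha> S :: ('l \<Rightarrow> 'p mod_ring) set) = 0"
      using ce S(1) by (auto simp: comb_equiv_def)
    then have "zeros (\<alpha> ` S) = ({0} :: ('l \<Rightarrow> 'p mod_ring) set)"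
      unfolding inter_hyp_eq_zeros sdim_zeros_eq_0_iff .
    moreover have "finite (\<alpha> ` S)" using S(1) finite_subset by blast
    ultimately show "sigma_lucky tord CARD('p) (ideal_gen (lin_poly ` \<alpha> ` S))"
      using lucky_of_zeros_trivial[OF assms(2)] by blast
  qed
  then show "good n \<alpha> TYPE('p) \<and> sk_lucky tord CARD('l) CARD('p) n \<alpha>"
    using good_of_comb_equiv[OF assms(1) ce] by blast
next
  assume gl: "good n \<alpha> TYPE('p) \<and> sk_lucky tord CARD('l) CARD('p) n \<alpha>"
  let ?A = "\<alpha> ` {..<n}"
  have ess: "zeros ?A = ({0} :: ('l \<Rightarrow> rat) set)"
    using assms(1) by (simp add: arrangement_def inter_hyp_eq_zeros)
  have bases: "zeros T = ({0} :: ('l \<Rightarrow> 'p mod_ring) set)"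
    if T: "T \<subseteq> ?A" "card T = CARD('l)" "zeros T = ({0} :: ('l \<Rightarrow> rat) set)" for T
  proof -
    \<comment> \<open>Luckiness counts indices while \<open>T\<close> counts forms; injectivity on
      \<open>S\<close> makes both numbers l.\<close>
    obtain S where S: "S \<subseteq> {..<n}" "inj_on \<alpha> S" "T = \<alpha> ` S"
      using T(1) by (auto simp: subset_image_inj)
    have "card S = CARD('l)" using S T(2) card_image by metis
    moreover have "sdim (inter_hyp \<alpha> S :: ('l \<Rightarrow> rat) set) = 0"
      using T(3) unfolding S(3) inter_hyp_eq_zeros sdim_zeros_eq_0_iff .
    ultimately have "sigma_lucky tord CARD('p) (ideal_gen (lin_poly ` T))"
      using gl S(1,3) by (simp add: sk_lucky_def)
    moreover have "finite T" using T(1) finite_subset by blast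
    ultimately show ?thesis using zeros_trivial_of_lucky[OF assms(2) _ T(3)] by blast
  qed
  show "comb_equiv n \<alpha> TYPE('p)"
    unfolding comb_equiv_def
  proof (intro allI impI, elim conjE)
    fix S assume S: "S \<subseteq> {..<n}"
    have fS: "finite (\<alpha> ` S)" using S finite_subset by blast
    have "zdim TYPE('p mod_ring) (\<alpha> ` S) \<le> zdim TYPE(rat) (\<alpha> ` S)"
      using zdim_le_of_bases[OF _ _ ess bases] S by (metis finite_imageI finite_lessThan image_mono)
    \<comment> \<open>This direction holds for every prime: trivial zeros modulo p imply trivial
      zeros over \<rat>.\<close>
    moreover have "zdim TYPE(rat) (\<alpha> ` S) \<le> zdim TYPE('p mod_ring) (\<alpha> ` S)"
      using fS zeros_trivial_rat by (intro zdim_le_of_trivial) blast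
    ultimately show "sdim (inter_hyp \<alpha> S :: ('l \<Rightarrow> rat) set)
        = sdim (inter_hyp \<alpha> S :: ('l \<Rightarrow> 'p mod_ring) set)"
      by (simp add: inter_hyp_eq_zeros sdim_zeros)
  qed
qed

end
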